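(* Let $(X,D,\alpha)$ be a complete metric type space and let $f:X\to X$ be a continuous function. Suppose that there exist functions $\eta,\lambda,\zeta,\mu,\xi:X\to[0,1)$ which satisfy the following for all $x,y\in X$: (1) $g(f(x))\le g(x)$ whenever $g\in\{\eta,\lambda,\zeta,\mu,\xi\}$; (2) $\eta(x)+\lambda(x)+\zeta(x)+\mu(x)+2\alpha\,\xi(x)<1$; (3) $D(f(x),f(y))\le \eta(x)D(x,y)+\lambda(x)D(x,f(x))+\zeta(x)D(y,f(y))+\mu(x)D(f(x),y)+\xi(x)D(x,f(y))$. Then $f$ has a unique fixed point.
   Context: A metric type space $(X,D,\alpha)$ consists of a nonempty set $X$, a function $D:X\times X\to[0,\infty)$ and a constant $\alpha\ge 1$ such that: (D1) $D(x,x)=0$ for all $x\in X$, and $D(x,y)=0$ implies $x=y$; (D2) $D(x,y)=D(y,x)$ for all $x,y\in X$; (D3) $D(x,y)\le\alpha\big(D(x,z_1)+D(z_1,z_2)+\cdots+D(z_n,y)\big)$ for all $x,y,z_1,\dots,z_n\in X$, where $n\ge1$ is a fixed natural number. Convergence, Cauchy sequences, completeness and continuity are defined as for metric spaces: $x_m\to x$ means $D(x_m,x)\to0$; $(x_m)$ is Cauchy if $D(x_m,x_k)\to0$ as $m,k\to\infty$; $X$ is complete if every Cauchy sequence in $X$ converges in $X$; $f$ is continuous if $x_m\to x$ implies $f(x_m)\to f(x)$. *)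

theory Defs
  imports Complex_Main "HOL-Library.FuncSet"
begin

text \<open>The number \<open>n\<close> of intermediate points in the relaxed polygonal inequality is fixed for the
  space, so it is a parameter of the structure; the intermediate points are \<open>z 1, \<dots>, z n\<close>, and
  for \<open>n = 1\<close> the middle sum is empty.\<close>

locale metric_type_space =
  fixes X :: "'a set" and D :: "'a \<Rightarrow> 'a \<Rightarrow> real" and \<alpha> :: real and n :: nat
  assumes nonempty: "X \<noteq> {}"
    and nonneg: "\<And>x y. x \<in> X \<Longrightarrow> y \<in> X \<Longrightarrow> 0 \<le> D x y"
    and alpha_ge_1: "1 \<le> \<alpha>"
    and n_ge_1: "1 \<le> n"
    and refl_zero: "\<And>x. x \<in> X \<Longrightarrow> D x x = 0"
    and zero_imp_eq: "\<And>x y. x \<in> X \<Longrightarrow> y \<in> X \<Longrightarrow> D x y = 0 \<Longrightarrow> x = y"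
    and symmetric: "\<And>x y. x \<in> X \<Longrightarrow> y \<in> X \<Longrightarrow> D x y = D y x"
    and polygonal: "\<And>x y z. x \<in> X \<Longrightarrow> y \<in> X \<Longrightarrow> (\<And>i. i \<in> {1..n} \<Longrightarrow> z i \<in> X) \<Longrightarrow>
      D x y \<le> \<alpha> * (D x (z 1) + (\<Sum>i = 1..<n. D (z i) (z (Suc i))) + D (z n) y)"
begin

definition tends_to :: "(nat \<Rightarrow> 'a) \<Rightarrow> 'a \<Rightarrow> bool" where
  "tends_to s l \<longleftrightarrow> range s \<subseteq> X \<and> l \<in> X \<and> (\<lambda>m. D (s m) l) \<longlonglongrightarrow> 0"

definition cauchy_seq :: "(nat \<Rightarrow> 'a) \<Rightarrow> bool" where
  "cauchy_seq s \<longleftrightarrow> range s \<subseteq> X \<and> (\<forall>\<epsilon>>0. \<exists>N. \<forall>m\<ge>N. \<forall>k\<ge>N. D (s m) (s k) < \<epsilon>)"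

definition complete_space :: bool where
  "complete_space \<longleftrightarrow> (\<forall>s. cauchy_seq s \<longrightarrow> (\<exists>l. tends_to s l))"

definition continuous_self_map :: "('a \<Rightarrow> 'a) \<Rightarrow> bool" where
  "continuous_self_map f \<longleftrightarrow> f \<in> X \<rightarrow> X \<and> (\<forall>s l. tends_to s l \<longrightarrow> tends_to (f \<circ> s) (f l))"

end

end

theory Submission
  imports Defs
begin

text \<open>
  Repeating one intermediate point in the polygonal inequality gives the relaxed triangle
  inequality \<open>D x y \<le> \<alpha> * (D x z + D z y)\<close>, and this weaker consequence carries the whole proof.

  Applied to consecutive points of the orbit \<open>x, f x, f (f x), \<dots>\<close>, the contraction condition
  loses its \<open>\<mu>\<close>-term, since that distance is \<open>0\<close>, and its \<open>\<xi>\<close>-term spans two steps, which the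
  relaxed triangle inequality splits at the price of one factor \<open>\<alpha>\<close>. The coefficients do not grow
  along the orbit, so the step lengths decrease geometrically with the ratio
  \<open>h = (\<eta> x + lam x + \<alpha> * \<xi> x) / (1 - \<zeta> x - \<alpha> * \<xi> x)\<close>, and \<open>h < 1\<close> follows from the bound on the
  sum of the coefficients.

  The delicate point is that geometrically decreasing steps form a Cauchy sequence for every
  \<open>h < 1\<close>. Because the number of intermediate points is fixed, long polygons can be
  split only by iterating the inequality, and splitting off one step at a time produces powers
  of \<open>\<alpha> * h\<close>, which may exceed \<open>1\<close>. Splitting off \<open>p\<close> steps at a time replaces \<open>\<alpha> * h\<close> by
  \<open>\<alpha> * h ^ p\<close>, which is small for large \<open>p\<close>; this is \<open>geometric_steps_bound\<close>. Completeness then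
  provides a limit of the orbit, continuity makes it a fixed point, and the contraction condition
  at two fixed points forces them to coincide.
\<close>

section \<open>Relaxed triangle inequality and limits\<close>

context metric_type_space
begin

lemma relaxed_triangle:
  assumes "x \<in> X" "y \<in> X" "z \<in> X"
  shows "D x y \<le> \<alpha> * (D x z + D z y)"
  using polygonal[of x y "\<lambda>_. z"] assms refl_zero by simp

lemma tends_to_unique:
  assumes s: "tends_to s l" "tends_to s l'"
  shows "l = l'"
proof -
  have X: "l \<in> X" "l' \<in> X" "\<And>m. s m \<in> X"
    and lim: "(\<lambda>m. D (s m) l) \<longlonglongrightarrow> 0" "(\<lambda>m. D (s m) l') \<longlonglongrightarrow> 0"
    using s unfolding tends_to_def by auto
  have "(\<lambda>m. \<alpha> * (D (s m) l + D (s m) l')) \<longlonglongrightarrow> \<alpha> * (0 + 0)"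
    by (intro tendsto_intros lim)
  moreover have "D l l' \<le> \<alpha> * (D (s m) l + D (s m) l')" for m
    using relaxed_triangle[of l l' "s m"] symmetric[of l "s m"] X by simp
  ultimately have "D l l' \<le> \<alpha> * (0 + 0)"
    by (intro LIMSEQ_le_const) auto
  then have "D l l' = 0"
    using nonneg[of l l'] X by simp
  then show ?thesis
    using zero_imp_eq X by blast
qed

lemma tends_to_Suc:
  assumes "tends_to s l"
  shows "tends_to (\<lambda>m. s (Suc m)) l"
  using assms LIMSEQ_Suc[of "\<lambda>m. D (s m) l" 0] unfolding tends_to_def by auto


section \<open>Sequences with geometrically decreasing steps\<close>

text \<open>For a bounded number of steps a crude estimate suffices: every further step costs one
  application of the relaxed triangle inequality, so the constant \<open>B\<close> grows with \<open>p\<close>, but it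
  does not depend on the starting index \<open>m\<close>.\<close>

lemma bounded_gap_bound:
  assumes s: "\<And>m. s m \<in> X"
    and h: "0 \<le> h" "h < 1"
    and c: "0 \<le> c" "\<And>m. D (s m) (s (Suc m)) \<le> c * h ^ m"
  shows "\<exists>B\<ge>0. \<forall>k\<le>p. \<forall>m. D (s m) (s (m + k)) \<le> B * h ^ m"
proof (induction p)
  case 0
  then show ?case
    using refl_zero s by (intro exI[of _ 0]) auto
next
  case (Suc p)
  then obtain B where B: "B \<ge> 0" "\<And>k m. k \<le> p \<Longrightarrow> D (s m) (s (m + k)) \<le> B * h ^ m"
    by blast
  have B'_nonneg: "0 \<le> \<alpha> * (c + B)"
    using alpha_ge_1 c(1) B(1) by simp
  have "D (s m) (s (m + k)) \<le> \<alpha> * (c + B) * h ^ m" if "k \<le> Suc p" for k m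
  proof (cases k)
    case 0
    then show ?thesis
      using refl_zero s h(1) B'_nonneg by simp
  next
    case (Suc j)
    have "D (s (Suc m)) (s (m + k)) \<le> B * h ^ Suc m"
      using B(2)[of j "Suc m"] Suc that by simp
    also have "\<dots> \<le> B * h ^ m"
      using B(1) h by (intro mult_left_mono power_decreasing) auto
    finally have tail: "D (s (Suc m)) (s (m + k)) \<le> B * h ^ m" .
    have "D (s m) (s (m + k)) \<le> \<alpha> * (D (s m) (s (Suc m)) + D (s (Suc m)) (s (m + k)))"
      using relaxed_triangle s by blast
    also have "\<dots> \<le> \<alpha> * (c * h ^ m + B * h ^ m)"
      using alpha_ge_1 c(2)[of m] tail by (intro mult_left_mono add_mono) auto
    finally show ?thesis
      by (simp add: algebra_simps)
  qed
  then show ?case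
    using B'_nonneg by blast
qed

text \<open>For arbitrary gaps, \<open>p\<close> is chosen so that \<open>\<alpha> * h ^ p < 1 / 2\<close>, and blocks of \<open>p\<close> steps are
  split off one at a time. If \<open>C * h ^ m\<close> bounds the shorter gaps, the remainder after one block,
  starting at \<open>m + p\<close>, contributes at most half of \<open>C * h ^ m\<close>, so the same constant survives
  once the block itself takes at most the other half.\<close>

lemma geometric_steps_bound:
  assumes s: "\<And>m. s m \<in> X"
    and h: "0 \<le> h" "h < 1"
    and c: "0 \<le> c" "\<And>m. D (s m) (s (Suc m)) \<le> c * h ^ m"
  shows "\<exists>C\<ge>0. \<forall>k m. D (s m) (s (m + k)) \<le> C * h ^ m"
proof -
  have "(\<lambda>p. \<alpha> * h ^ p) \<longlonglongrightarrow> \<alpha> * 0"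
    using h by (intro tendsto_intros LIMSEQ_realpow_zero) auto
  then have "\<forall>\<^sub>F p in sequentially. \<alpha> * h ^ p < 1 / 2"
    by (rule order_tendstoD) simp
  then obtain p where p: "\<alpha> * h ^ p < 1 / 2"
    by (auto simp: eventually_sequentially)
  \<comment> \<open>The empty block is excluded because \<open>\<alpha> \<ge> 1\<close>; hence splitting off a block shortens the gap.\<close>
  have p_pos: "p > 0"
    using p alpha_ge_1 by (cases p) auto
  obtain B where B: "B \<ge> 0" "\<And>k m. k \<le> p \<Longrightarrow> D (s m) (s (m + k)) \<le> B * h ^ m"
    using bounded_gap_bound[OF s h c, of p] by blast
  define C where "C = 2 * \<alpha> * B"
  have "1 * B \<le> (2 * \<alpha>) * B"
    using alpha_ge_1 B(1) by (intro mult_right_mono) auto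
  then have "B \<le> C"
    by (simp add: C_def)
  with B(1) have C: "B \<le> C" "0 \<le> C"
    by auto
  have "D (s m) (s (m + k)) \<le> C * h ^ m" for k m
  proof (induction k arbitrary: m rule: less_induct)
    case (less k)
    show ?case
    proof (cases "k \<le> p")
      case True
      have "D (s m) (s (m + k)) \<le> B * h ^ m"
        by (rule B(2)[OF True])
      also have "\<dots> \<le> C * h ^ m"
        using C(1) h(1) by (intro mult_right_mono) auto
      finally show ?thesis .
    next
      case False
      have tail: "D (s (m + p)) (s (m + k)) \<le> C * h ^ (m + p)"
        using less.IH[of "k - p" "m + p"] False p_pos by simp
      have "(\<alpha> * h ^ p) * (C * h ^ m) \<le> (1 / 2) * (C * h ^ m)"
        using p C(2) h(1) by (intro mult_right_mono) auto
      then have half: "\<alpha> * (C * h ^ (m + p)) \<le> C * h ^ m / 2"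
        by (simp add: power_add algebra_simps)
      have "D (s m) (s (m + k)) \<le> \<alpha> * (D (s m) (s (m + p)) + D (s (m + p)) (s (m + k)))"
        using relaxed_triangle s by blast
      also have "\<dots> \<le> \<alpha> * (B * h ^ m + C * h ^ (m + p))"
        using alpha_ge_1 B(2)[of p m] tail by (intro mult_left_mono add_mono) auto
      also have "\<dots> = C * h ^ m / 2 + \<alpha> * (C * h ^ (m + p))"
        by (simp add: C_def algebra_simps)
      also have "\<dots> \<le> C * h ^ m"
        using half by simp
      finally show ?thesis .
    qed
  qed
  then show ?thesis
    using C(2) by blast
qed

lemma cauchy_seq_if_geometric_steps:
  assumes s: "\<And>m. s m \<in> X"
    and h: "0 \<le> h" "h < 1"
    and c: "0 \<le> c" "\<And>m. D (s m) (s (Suc m)) \<le> c * h ^ m"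
  shows "cauchy_seq s"
proof -
  obtain C where C: "C \<ge> 0" "\<And>k m. D (s m) (s (m + k)) \<le> C * h ^ m"
    using geometric_steps_bound[OF s h c] by blast
  have "\<exists>N. \<forall>m\<ge>N. \<forall>k\<ge>N. D (s m) (s k) < \<epsilon>" if "\<epsilon> > 0" for \<epsilon>
  proof -
    have "(\<lambda>m. C * h ^ m) \<longlonglongrightarrow> C * 0"
      using h by (intro tendsto_intros LIMSEQ_realpow_zero) auto
    then have "\<forall>\<^sub>F m in sequentially. C * h ^ m < \<epsilon>"
      using that by (intro order_tendstoD) auto
    then obtain N where N: "\<And>m. m \<ge> N \<Longrightarrow> C * h ^ m < \<epsilon>"
      by (auto simp: eventually_sequentially)
    have "D (s m) (s k) < \<epsilon>" if "m \<ge> N" "m \<le> k" for m k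
      using C(2)[of m "k - m"] N[of m] that by simp
    then show ?thesis
      using symmetric[OF s s] by (metis nle_le)
  qed
  then show ?thesis
    using s unfolding cauchy_seq_def by auto
qed

text \<open>A map that contracts the steps of an orbit therefore has a fixed point: the shifted orbit
  converges both to the limit of the orbit and to the image of that limit.\<close>

lemma fixed_point_if_orbit_contracts:
  assumes complete: complete_space
    and cont: "continuous_self_map f"
    and x: "x \<in> X"
    and h: "0 \<le> h" "h < 1"
    and step: "\<And>m. D ((f ^^ Suc m) x) ((f ^^ Suc (Suc m)) x)
                 \<le> h * D ((f ^^ m) x) ((f ^^ Suc m) x)"
  shows "\<exists>u\<in>X. f u = u"
proof -
  define s where "s m = (f ^^ m) x" for m
  have f: "\<And>y. y \<in> X \<Longrightarrow> f y \<in> X"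
    using cont unfolding continuous_self_map_def by auto
  have s: "s m \<in> X" for m
    by (induction m) (auto simp: s_def x f)
  have steps: "D (s m) (s (Suc m)) \<le> D (s 0) (s (Suc 0)) * h ^ m" for m
  proof (induction m)
    case (Suc m)
    have "D (s (Suc m)) (s (Suc (Suc m))) \<le> h * D (s m) (s (Suc m))"
      using step unfolding s_def .
    also have "\<dots> \<le> h * (D (s 0) (s (Suc 0)) * h ^ m)"
      using Suc h(1) by (rule mult_left_mono)
    finally show ?case
      by (simp add: mult_ac)
  qed simp
  have "cauchy_seq s"
    by (rule cauchy_seq_if_geometric_steps[OF s h nonneg[OF s s] steps])
  then obtain u where u: "tends_to s u"
    using complete unfolding complete_space_def by blast
  have "tends_to (f \<circ> s) (f u)"
    using cont u unfolding continuous_self_map_def by blast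
  moreover have "f \<circ> s = (\<lambda>m. s (Suc m))"
    by (auto simp: s_def)
  ultimately have "f u = u"
    using tends_to_unique tends_to_Suc[OF u] by metis
  moreover have "u \<in> X"
    using u unfolding tends_to_def by blast
  ultimately show ?thesis
    by blast
qed

end


section \<open>The fixed point theorem\<close>

theorem theorem3p2:
  fixes X :: "'a set" and D :: "'a \<Rightarrow> 'a \<Rightarrow> real" and \<alpha> :: real and n :: nat
    and f :: "'a \<Rightarrow> 'a" and \<eta> lam \<zeta> \<mu> \<xi> :: "'a \<Rightarrow> real"
  assumes "metric_type_space X D \<alpha> n"
    and "metric_type_space.complete_space X D"
    and "metric_type_space.continuous_self_map X D f"
    and "\<eta> \<in> X \<rightarrow> {0..<1}" and "lam \<in> X \<rightarrow> {0..<1}" and "\<zeta> \<in> X \<rightarrow> {0..<1}"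
    and "\<mu> \<in> X \<rightarrow> {0..<1}" and "\<xi> \<in> X \<rightarrow> {0..<1}"
    and "\<And>g x. g \<in> {\<eta>, lam, \<zeta>, \<mu>, \<xi>} \<Longrightarrow> x \<in> X \<Longrightarrow> g (f x) \<le> g x"
    and "\<And>x. x \<in> X \<Longrightarrow> \<eta> x + lam x + \<zeta> x + \<mu> x + 2 * \<alpha> * \<xi> x < 1"
    and "\<And>x y. x \<in> X \<Longrightarrow> y \<in> X \<Longrightarrow>
           D (f x) (f y) \<le> \<eta> x * D x y + lam x * D x (f x) + \<zeta> x * D y (f y)
             + \<mu> x * D (f x) y + \<xi> x * D x (f y)"
  shows "\<exists>!x. x \<in> X \<and> f x = x"
proof -
  interpret metric_type_space X D \<alpha> n
    by (rule assms(1))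
  note range = assms(4-8) and contr = assms(11)
  have f: "\<And>x. x \<in> X \<Longrightarrow> f x \<in> X"
    using assms(3) unfolding continuous_self_map_def by auto
  have coeff_nonneg: "0 \<le> \<eta> x" "0 \<le> lam x" "0 \<le> \<zeta> x" "0 \<le> \<mu> x" "0 \<le> \<xi> x" if "x \<in> X" for x
    using range[THEN funcset_mem, OF that] by auto
  have alpha_xi: "\<xi> x \<le> \<alpha> * \<xi> x" if "x \<in> X" for x
    using mult_right_mono[OF alpha_ge_1 coeff_nonneg(5)[OF that]] by simp
  obtain x where x: "x \<in> X"
    using nonempty by blast
  define h where "h = (\<eta> x + lam x + \<alpha> * \<xi> x) / (1 - \<zeta> x - \<alpha> * \<xi> x)"
  have denom: "\<eta> x + lam x + \<alpha> * \<xi> x < 1 - \<zeta> x - \<alpha> * \<xi> x"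
    using assms(10)[OF x] coeff_nonneg(4)[OF x] by (simp add: algebra_simps)
  have numer: "0 \<le> \<eta> x + lam x + \<alpha> * \<xi> x"
    using coeff_nonneg[OF x] alpha_xi[OF x] by linarith
  have h: "0 \<le> h" "h < 1"
    using numer denom by (simp_all add: h_def)
  have orbit: "(f ^^ m) x \<in> X" for m
    by (induction m) (auto simp: x f)
  have coeff_le: "g ((f ^^ m) x) \<le> g x" if "g \<in> {\<eta>, lam, \<zeta>, \<mu>, \<xi>}" for g m
  proof (induction m)
    case (Suc m)
    then show ?case
      using assms(9)[OF that orbit[of m]] by simp
  qed simp
  have step: "D ((f ^^ Suc m) x) ((f ^^ Suc (Suc m)) x) \<le> h * D ((f ^^ m) x) ((f ^^ Suc m) x)"
    for m
  proof -
    define y where "y = (f ^^ m) x"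
    have y: "y \<in> X" "f y \<in> X" "f (f y) \<in> X"
      using orbit[of m] f by (auto simp: y_def)
    define a b where "a = D y (f y)" and "b = D (f y) (f (f y))"
    have ab: "0 \<le> a" "0 \<le> b"
      using nonneg y by (auto simp: a_def b_def)
    have le: "\<eta> y \<le> \<eta> x" "lam y \<le> lam x" "\<zeta> y \<le> \<zeta> x" "\<xi> y \<le> \<xi> x"
      using coeff_le by (auto simp: y_def)
    have two_steps: "D y (f (f y)) \<le> \<alpha> * (a + b)"
      using relaxed_triangle y unfolding a_def b_def by blast
    have "b \<le> \<eta> y * a + lam y * a + \<zeta> y * b + \<xi> y * D y (f (f y))"
      using contr[OF y(1,2)] refl_zero[OF y(2)] by (simp add: a_def b_def)
    also have "\<dots> \<le> \<eta> x * a + lam x * a + \<zeta> x * b + \<xi> x * (\<alpha> * (a + b))"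
      using le ab two_steps nonneg[OF y(1,3)] coeff_nonneg[OF x]
      by (intro add_mono mult_mono) auto
    finally have "b * (1 - \<zeta> x - \<alpha> * \<xi> x) \<le> (\<eta> x + lam x + \<alpha> * \<xi> x) * a"
      by (simp add: algebra_simps)
    then have "b \<le> h * a"
      using numer denom by (simp add: h_def pos_le_divide_eq)
    then show ?thesis
      by (simp add: a_def b_def y_def)
  qed
  have "\<exists>u\<in>X. f u = u"
    using fixed_point_if_orbit_contracts[OF assms(2,3) x h step] .
  moreover have "u = v" if "u \<in> X" "f u = u" "v \<in> X" "f v = v" for u v
  proof -
    have "D u v \<le> (\<eta> u + \<mu> u + \<xi> u) * D u v"
      using contr[OF that(1,3)] that refl_zero by (simp add: algebra_simps)
    moreover have "\<eta> u + \<mu> u + \<xi> u < 1"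
      using assms(10)[OF that(1)] coeff_nonneg[OF that(1)] alpha_xi[OF that(1)] by linarith
    ultimately have "D u v \<le> 0"
      by (smt (verit) mult_less_cancel_right2)
    then show ?thesis
      using nonneg[OF that(1,3)] zero_imp_eq[OF that(1,3)] by linarith
  qed
  ultimately show ?thesis
    by blast
qed

end
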